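(* Let $$\mathbf B_r=\inf\big\{B_f:\ f:\mathbb B\to\mathbb H \text{ slice regular},\ f(0)=0,\ f'(0)=1,\ \|f\|_{\mathcal B_r}\le1\big\},$$ where $\|f\|_{\mathcal B_r}=\sup_{q\in\mathbb B}(1-|q|^2)|f'(q)|$, and where, for a slice regular function $f$ on $\mathbb B$, $B_f$ denotes the least upper bound of all numbers $R>0$ such that there exist a point $q_0\in\mathbb H$ and a domain $\Omega\subset\mathbb B$ for which the restriction $f|_\Omega:\Omega\to B(q_0,R)$ is a homeomorphism. Then $\mathbf B_r>0.23$.
   Context: $\mathbb H$ is the skew field of quaternions, $|\cdot|$ its Euclidean norm, $\mathbb S=\{q\in\mathbb H:q^2=-1\}$. For $I\in\mathbb S$, $\mathbb C_I=\mathbb R+\mathbb R I$, and for $\Omega\subset\mathbb H$, $\Omega_I=\Omega\cap\mathbb C_I$. $B(q_0,R)=\{q\in\mathbb H:|q-q_0|<R\}$ and $\mathbb B=B(0,1)$. A domain is a nonempty connected open set. A function $f:\Omega\to\mathbb H$ on a domain $\Omega\subset\mathbb H$ is slice regular if for every $I\in\mathbb S$ its restriction $f_I$ to $\Omega_I$ has continuous partial derivatives and satisfies $\frac12\big(\frac{\partial}{\partial x}+I\frac{\partial}{\partial y}\big)f_I(x+yI)=0$ for all $x+yI\in\Omega_I$. On $\mathbb B$ this is equivalent to $f(q)=\sum_{n\ge0}q^na_n$ with $a_n\in\mathbb H$, the series converging absolutely and uniformly on compact subsets of $\mathbb B$. The slice derivative $f'$ is defined on each $\mathbb B_I$ by $f'(x+yI)=\frac12\big(\frac{\partial}{\partial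 x}-I\frac{\partial}{\partial y}\big)f_I(x+yI)$; equivalently $f'(q)=\sum_{n\ge1}q^{n-1}na_n$. It is well defined and slice regular. *)

theory Defs
  imports "HOL-Analysis.Analysis"
begin

section \<open>The skew field of quaternions\<close>

codatatype quat = Quat (qre: real) (qi: real) (qj: real) (qk: real)

lemma quat_eq_iff:
  "x = y \<longleftrightarrow> qre x = qre y \<and> qi x = qi y \<and> qj x = qj y \<and> qk x = qk y"
  by (auto intro: quat.expand)

instantiation quat :: ab_group_add
begin

primcorec zero_quat where
  "qre 0 = 0" | "qi 0 = 0" | "qj 0 = 0" | "qk 0 = 0"

primcorec plus_quat where
  "qre (x + y) = qre x + qre y"
| "qi (x + y) = qi x + qi y"
| "qj (x + y) = qj x + qj y"
| "qk (x + y) = qk x + qk y"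

primcorec uminus_quat where
  "qre (- x) = - qre x"
| "qi (- x) = - qi x"
| "qj (- x) = - qj x"
| "qk (- x) = - qk x"

primcorec minus_quat where
  "qre (x - y) = qre x - qre y"
| "qi (x - y) = qi x - qi y"
| "qj (x - y) = qj x - qj y"
| "qk (x - y) = qk x - qk y"

instance
  by standard (simp_all add: quat_eq_iff)

end

instantiation quat :: ring_1
begin

primcorec one_quat where
  "qre 1 = 1" | "qi 1 = 0" | "qj 1 = 0" | "qk 1 = 0"

primcorec times_quat where
  "qre (x * y) = qre x * qre y - qi x * qi y - qj x * qj y - qk x * qk y"
| "qi (x * y) = qre x * qi y + qi x * qre y + qj x * qk y - qk x * qj y"
| "qj (x * y) = qre x * qj y - qi x * qk y + qj x * qre y + qk x * qi y"
| "qk (x * y) = qre x * qk y + qi x * qj y - qj x * qi y + qk x * qre y"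

instance
  by standard (simp_all add: quat_eq_iff algebra_simps)

end

instantiation quat :: real_algebra_1
begin

primcorec scaleR_quat where
  "qre (scaleR r x) = r * qre x"
| "qi (scaleR r x) = r * qi x"
| "qj (scaleR r x) = r * qj x"
| "qk (scaleR r x) = r * qk x"

instance
  by standard (simp_all add: quat_eq_iff algebra_simps)

end

instantiation quat :: real_div_algebra
begin

definition inverse_quat :: "quat \<Rightarrow> quat" where
  "inverse x =
     (1 / ((qre x)\<^sup>2 + (qi x)\<^sup>2 + (qj x)\<^sup>2 + (qk x)\<^sup>2)) *\<^sub>R
     Quat (qre x) (- qi x) (- qj x) (- qk x)"

definition divide_quat :: "quat \<Rightarrow> quat \<Rightarrow> quat" where
  "x div y = x * inverse y" for x y :: quat

instance
proof
  fix x y :: quat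
  have pos: "(qre x)\<^sup>2 + (qi x)\<^sup>2 + (qj x)\<^sup>2 + (qk x)\<^sup>2 \<noteq> 0" if "x \<noteq> 0"
    using that by (auto simp: quat_eq_iff add_nonneg_eq_0_iff)
  show "inverse x * x = 1" if "x \<noteq> 0"
    using pos[OF that]
    by (simp add: quat_eq_iff inverse_quat_def field_simps power2_eq_square)
  show "x * inverse x = 1" if "x \<noteq> 0"
    using pos[OF that]
    by (simp add: quat_eq_iff inverse_quat_def field_simps power2_eq_square)
  show "x div y = x * inverse y"
    by (rule divide_quat_def)
  show "inverse (0::quat) = 0"
    by (simp add: quat_eq_iff inverse_quat_def)
qed

end

instantiation quat :: real_inner
begin

definition inner_quat :: "quat \<Rightarrow> quat \<Rightarrow> real" where
  "inner_quat x y = qre x * qre y + qi x * qi y + qj x * qj y + qk x * qk y"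

definition norm_quat :: "quat \<Rightarrow> real" where
  "norm_quat x = sqrt ((qre x)\<^sup>2 + (qi x)\<^sup>2 + (qj x)\<^sup>2 + (qk x)\<^sup>2)"

definition sgn_quat :: "quat \<Rightarrow> quat" where
  "sgn_quat x = x /\<^sub>R norm x"

definition dist_quat :: "quat \<Rightarrow> quat \<Rightarrow> real" where
  "dist_quat x y = norm (x - y)"

definition uniformity_quat :: "(quat \<times> quat) filter" where
  "uniformity_quat = (INF e\<in>{0<..}. principal {(x, y). dist x y < e})"

definition open_quat :: "quat set \<Rightarrow> bool" where
  "open_quat U \<longleftrightarrow> (\<forall>x\<in>U. eventually (\<lambda>(x', y). x' = x \<longrightarrow> y \<in> U) uniformity)"

instance
proof
  fix x y z :: quat and r :: real and U :: "quat set"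
  show "dist x y = norm (x - y)" by (rule dist_quat_def)
  show "sgn x = x /\<^sub>R norm x" by (rule sgn_quat_def)
  show "(uniformity :: (quat \<times> quat) filter) =
      (INF e\<in>{0<..}. principal {(x, y). dist x y < e})"
    by (rule uniformity_quat_def)
  show "open U \<longleftrightarrow> (\<forall>x\<in>U. eventually (\<lambda>(x', y). x' = x \<longrightarrow> y \<in> U) uniformity)"
    by (rule open_quat_def)
  show "inner x y = inner y x"
    by (simp add: inner_quat_def algebra_simps)
  show "inner (x + y) z = inner x z + inner y z"
    by (simp add: inner_quat_def algebra_simps)
  show "inner (scaleR r x) y = r * inner x y"
    by (simp add: inner_quat_def algebra_simps)
  show "0 \<le> inner x x"
    by (simp add: inner_quat_def)
  show "inner x x = 0 \<longleftrightarrow> x = 0"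
    by (auto simp: inner_quat_def quat_eq_iff add_nonneg_eq_0_iff)
  show "norm x = sqrt (inner x x)"
    by (simp add: inner_quat_def norm_quat_def power2_eq_square)
qed

end

instance quat :: real_normed_div_algebra
proof
  fix x y :: quat
  show "norm (x * y) = norm x * norm y"
    unfolding norm_quat_def real_sqrt_mult [symmetric]
    by (simp add: power2_eq_square algebra_simps)
qed

instantiation quat :: euclidean_space
begin

definition Basis_quat :: "quat set" where
  "Basis_quat = {Quat 1 0 0 0, Quat 0 1 0 0, Quat 0 0 1 0, Quat 0 0 0 1}"

instance
proof
  fix u v x :: quat
  show "(Basis :: quat set) \<noteq> {}" "finite (Basis :: quat set)"
    by (simp_all add: Basis_quat_def)
  show "inner u v = (if u = v then 1 else 0)" if "u \<in> Basis" "v \<in> Basis"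
    using that unfolding Basis_quat_def
    by (elim insertE emptyE) (simp_all add: inner_quat_def)
  show "(\<forall>u\<in>Basis. inner x u = 0) \<longleftrightarrow> x = 0"
    unfolding quat_eq_iff[of x 0] by (simp add: Basis_quat_def inner_quat_def)
qed

end


section \<open>Slice regular functions and the slice derivative\<close>

definition imag_units :: "quat set" where
  "imag_units = {q. q\<^sup>2 = -1}"

definition slice_pt :: "quat \<Rightarrow> real \<Rightarrow> real \<Rightarrow> quat" where
  "slice_pt I x y = of_real x + y *\<^sub>R I"

definition slice_dx :: "(quat \<Rightarrow> quat) \<Rightarrow> quat \<Rightarrow> real \<Rightarrow> real \<Rightarrow> quat" where
  "slice_dx f I x y = vector_derivative (\<lambda>s. f (slice_pt I s y)) (at x)"

definition slice_dy :: "(quat \<Rightarrow> quat) \<Rightarrow> quat \<Rightarrow> real \<Rightarrow> real \<Rightarrow> quat" where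
  "slice_dy f I x y = vector_derivative (\<lambda>t. f (slice_pt I x t)) (at y)"

text \<open>
  Only used for open \<open>\<Omega>\<close>. The slice \<open>\<Omega> \<inter> (\<real> + \<real>I)\<close> is given by its real coordinates.
\<close>

definition slice_regular_on :: "(quat \<Rightarrow> quat) \<Rightarrow> quat set \<Rightarrow> bool" where
  "slice_regular_on f \<Omega> \<longleftrightarrow>
     (\<forall>I\<in>imag_units.
        let D = {(x, y). slice_pt I x y \<in> \<Omega>} in
          (\<forall>(x, y)\<in>D. (\<lambda>s. f (slice_pt I s y)) differentiable (at x) \<and>
                       (\<lambda>t. f (slice_pt I x t)) differentiable (at y)) \<and>
          continuous_on D (\<lambda>(x, y). slice_dx f I x y) \<and>
          continuous_on D (\<lambda>(x, y). slice_dy f I x y) \<and>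
          (\<forall>(x, y)\<in>D. (1/2) *\<^sub>R (slice_dx f I x y + I * slice_dy f I x y) = 0))"

text \<open>
  The value must be the same for every representation \<open>q = x + yI\<close>; for slice regular
  functions it is, by \<open>slice_deriv_eq\<close> below.
\<close>

definition slice_deriv :: "(quat \<Rightarrow> quat) \<Rightarrow> quat \<Rightarrow> quat" where
  "slice_deriv f q =
     (THE d. \<forall>I\<in>imag_units. \<forall>x y. q = slice_pt I x y \<longrightarrow>
        d = (1/2) *\<^sub>R (slice_dx f I x y - I * slice_dy f I x y))"

lemma imag_units_iff: "I \<in> imag_units \<longleftrightarrow> qre I = 0 \<and> norm I = 1"
proof
  assume "I \<in> imag_units"
  then have eq: "I * I = -1"
    by (simp add: imag_units_def power2_eq_square)
  then have "norm I * norm I = 1"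
    by (metis norm_minus_cancel norm_mult norm_one)
  then have n: "norm I = 1"
    by (simp add: abs_square_eq_1 flip: power2_eq_square)
  have e: "qre I * qre I - qi I * qi I - qj I * qj I - qk I * qk I = -1"
      and e': "qre I * qi I = 0" "qre I * qj I = 0" "qre I * qk I = 0"
    using eq by (auto simp: quat_eq_iff)
  have "qre I = 0"
  proof (rule ccontr)
    assume "qre I \<noteq> 0"
    then have "qre I * qre I = -1" using e e' by auto
    moreover have "0 \<le> qre I * qre I" by simp
    ultimately show False by linarith
  qed
  with n show "qre I = 0 \<and> norm I = 1" by simp
next
  assume "qre I = 0 \<and> norm I = 1"
  then show "I \<in> imag_units"
    by (auto simp: imag_units_def norm_quat_def quat_eq_iff power2_eq_square)
qed

lemma qre_of_real [simp]:
  "qre (of_real x) = x" "qi (of_real x) = 0" "qj (of_real x) = 0" "qk (of_real x) = 0"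
  by (simp_all add: of_real_def)

lemma slice_pt_eq_cases:
  assumes "I \<in> imag_units" "J \<in> imag_units" and eq: "slice_pt I x y = slice_pt J x' y'"
  obtains "x' = x" "y = 0" "y' = 0" | "x' = x" "J = I" "y' = y" | "x' = x" "J = - I" "y' = - y"
proof -
  have [simp]: "qre I = 0" "qre J = 0" and n: "norm I = 1" "norm J = 1"
    using assms by (auto simp: imag_units_iff)
  have x: "x' = x"
    using arg_cong[OF eq, of qre] by (simp add: slice_pt_def)
  then have yI: "y *\<^sub>R I = y' *\<^sub>R J"
    using eq by (simp add: slice_pt_def)
  then have "\<bar>y\<bar> = \<bar>y'\<bar>"
    using n by (metis yI norm_scaleR mult.right_neutral)
  then consider "y = 0" "y' = 0" | "y' = y" "y \<noteq> 0" | "y' = - y" "y \<noteq> 0"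
    by linarith
  then show thesis
  proof cases
    case 1
    show ?thesis by (rule that(1)[OF x 1])
  next
    case 2
    then have "J = I" using yI by (metis scaleR_cancel_left)
    then show ?thesis by (rule that(2)[OF x _ 2(1)])
  next
    case 3
    then have "y *\<^sub>R I = y *\<^sub>R (- J)"
      using yI by (metis scaleR_minus_left scaleR_minus_right)
    then have "J = - I"
      using 3 by (metis scaleR_cancel_left minus_minus)
    then show ?thesis by (rule that(3)[OF x _ 3(1)])
  qed
qed

lemma ex_imag_unit_rep: "\<exists>I\<in>imag_units. \<exists>x y. q = slice_pt I x y"
proof -
  define v where "v = q - of_real (qre q)"
  have v: "qre v = 0" "q = of_real (qre q) + v" by (auto simp: v_def)
  show ?thesis
  proof (cases "v = 0")
    case True
    have "Quat 0 1 0 0 \<in> imag_units" by (simp add: imag_units_iff norm_quat_def)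
    moreover have "q = slice_pt (Quat 0 1 0 0) (qre q) 0" using v True by (simp add: slice_pt_def)
    ultimately show ?thesis by blast
  next
    case False
    have "sgn v \<in> imag_units"
      using v False by (simp add: imag_units_iff norm_sgn sgn_quat_def)
    moreover have "q = slice_pt (sgn v) (qre q) (norm v)"
      using v False by (simp add: slice_pt_def sgn_div_norm)
    ultimately show ?thesis by blast
  qed
qed

lemma slice_deriv_eq:
  assumes reg: "slice_regular_on f \<Omega>" and I: "I \<in> imag_units" and mem: "slice_pt I x y \<in> \<Omega>"
  shows "slice_deriv f (slice_pt I x y) = (1/2) *\<^sub>R (slice_dx f I x y - I * slice_dy f I x y)"
proof -
  define d where "d K u v = (1/2) *\<^sub>R (slice_dx f K u v - K * slice_dy f K u v)" for K u v
  have cr: "slice_dx f K u v + K * slice_dy f K u v = 0"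
    if "K \<in> imag_units" "slice_pt K u v \<in> \<Omega>" for K u v
    using reg that by (force simp: slice_regular_on_def Let_def)
  have d_real: "d K u v = slice_dx f K u v"
    if "K \<in> imag_units" "slice_pt K u v \<in> \<Omega>" for K u v
  proof -
    have "K * slice_dy f K u v = - slice_dx f K u v"
      using cr[OF that] by (simp add: eq_neg_iff_add_eq_0 add.commute)
    then show ?thesis by (simp add: d_def scaleR_2 [symmetric])
  qed
  have uniq: "d J x' y' = d I x y"
    if J: "J \<in> imag_units" and eq: "slice_pt I x y = slice_pt J x' y'" for J x' y'
  proof -
    have *: "d J x' y' = slice_dx f J x' y'" "d I x y = slice_dx f I x y"
      using d_real I J mem eq by auto
    have "slice_dx f J x' y' = slice_dx f I x y"
      using I J eq
      by (rule slice_pt_eq_cases) (simp_all add: slice_dx_def slice_pt_def)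
    then show ?thesis using * by simp
  qed
  have "slice_deriv f (slice_pt I x y) = d I x y"
    unfolding slice_deriv_def d_def[symmetric]
  proof (rule the_equality)
    show "\<forall>J\<in>imag_units. \<forall>x' y'. slice_pt I x y = slice_pt J x' y' \<longrightarrow> d I x y = d J x' y'"
      using uniq by metis
  next
    fix e
    assume "\<forall>J\<in>imag_units. \<forall>x' y'. slice_pt I x y = slice_pt J x' y' \<longrightarrow> e = d J x' y'"
    then show "e = d I x y" using I by blast
  qed
  then show ?thesis by (simp add: d_def)
qed


section \<open>The Bloch seminorm and the Bloch constant\<close>

text \<open>
  The suprema and the infimum are taken in the extended reals, so none of them needs
  to be finite; the supremum of the empty set is \<open>-\<infinity>\<close>.
\<close>

definition bloch_norm :: "(quat \<Rightarrow> quat) \<Rightarrow> ereal" where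
  "bloch_norm f = (SUP q\<in>ball 0 1. ereal ((1 - (norm q)\<^sup>2) * norm (slice_deriv f q)))"

definition bloch_radius :: "(quat \<Rightarrow> quat) \<Rightarrow> ereal" where
  "bloch_radius f =
     (SUP R\<in>{R. R > 0 \<and>
        (\<exists>q0 \<Omega>. \<Omega> \<subseteq> ball 0 1 \<and> open \<Omega> \<and> connected \<Omega> \<and> \<Omega> \<noteq> {} \<and>
           (\<exists>g. homeomorphism \<Omega> (ball q0 R) f g))}. ereal R)"

definition bloch_const :: ereal where
  "bloch_const =
     (INF f\<in>{f. slice_regular_on f (ball 0 1) \<and> f 0 = 0 \<and> slice_deriv f 0 = 1 \<and>
               bloch_norm f \<le> 1}. bloch_radius f)"

end

theory Submission
  imports Defs "HOL-Complex_Analysis.Complex_Analysis"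
begin

text \<open>
  The theorem follows because \<open>f\<close> is so close to the identity on the ball of radius \<open>7/20\<close>
  that it is injective there and covers the ball of radius \<open>0.24\<close> about the origin.

  On each slice \<open>f\<close> is described by complex holomorphic functions: if \<open>\<lambda>\<close> is a real linear map
  from the quaternions to the complex numbers that turns left multiplication by \<open>I\<close> into
  multiplication by \<open>\<i>\<close>, then \<open>\<lambda> \<circ> f\<close> is holomorphic on the slice of \<open>I\<close>
  (\<open>slice_has_field_derivative\<close>). There are enough such maps to recover \<open>f\<close>. All slices meet in
  the real axis, so the Taylor coefficients at \<open>0\<close> do not depend on \<open>I\<close>, and
  \<open>f(q) = \<Sum> q\<^sup>n a\<^sub>n\<close> (\<open>slice_power_series\<close>).

  Let \<open>f(0) = 0\<close>, \<open>f'(0) = 1\<close> and \<open>(1 - |q|\<^sup>2) |f'(q)| \<le> 1\<close>. Then \<open>a\<^sub>0 = 0\<close>, \<open>a\<^sub>1 = 1\<close>, and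
  \<open>a\<^sub>2 = 0\<close> because equality holds in the last bound at \<open>q = 0\<close> (\<open>slice_coeff_2_eq_0\<close>). The
  Cauchy estimate for \<open>f'\<close> on \<open>|q| = 3/4\<close> gives \<open>n |a\<^sub>n| \<le> (16/7) (4/3)\<^bsup>n-1\<^esup>\<close>. Consequently
  \<open>h(q) = f(q) - q = \<Sum>\<^bsub>n\<ge>3\<^esub> q\<^sup>n a\<^sub>n\<close> is Lipschitz on \<open>|q| \<le> 7/20\<close> with constant
  \<open>(16/7) \<Sum>\<^bsub>n\<ge>3\<^esub> (7/15)\<^bsup>n-1\<^esup> = 14/15 < 1\<close>, and \<open>|h| \<le> (1/3) (7/20) (14/15) < 0.11\<close> there. By
  Banach's fixed point theorem a perturbation of the identity of this kind maps some domain in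
  the ball of radius \<open>7/20\<close> homeomorphically onto the ball of radius \<open>7/20 - 0.11 = 0.24\<close>
  (\<open>perturbed_identity_homeomorphism\<close>).
\<close>

section \<open>Complex coordinates on slices\<close>

text \<open>The embedding \<open>x + \<i>y \<mapsto> x + yI\<close> of the complex numbers onto the slice of \<open>I\<close>.\<close>

definition slice_emb :: "quat \<Rightarrow> complex \<Rightarrow> quat" where
  "slice_emb I z = slice_pt I (Re z) (Im z)"

text \<open>
  The complex-valued linear map on the quaternions, complex linear for left multiplication by
  \<open>I\<close>, whose real part is the inner product with \<open>u\<close>.
\<close>

definition slice_proj :: "quat \<Rightarrow> quat \<Rightarrow> quat \<Rightarrow> complex" where
  "slice_proj I u q = Complex (u \<bullet> q) (- (u \<bullet> (I * q)))"

lemma norm_slice_emb: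
  assumes "I \<in> imag_units"
  shows "norm (slice_emb I z) = norm z"
  using assms
  by (auto simp: imag_units_iff slice_emb_def slice_pt_def norm_quat_def cmod_def
      power_mult_distrib simp flip: distrib_left)

lemma slice_emb_mult:
  assumes "I \<in> imag_units"
  shows "slice_emb I (z * w) = slice_emb I z * slice_emb I w"
proof -
  have I: "I * I = -1" using assms by (simp add: imag_units_def power2_eq_square)
  show ?thesis
    by (simp add: slice_emb_def slice_pt_def algebra_simps I of_real_def scaleR_left_diff_distrib)
qed

lemma slice_emb_of_real [simp]: "slice_emb I (of_real x) = of_real x"
  by (simp add: slice_emb_def slice_pt_def)

lemma slice_emb_power:
  assumes "I \<in> imag_units"
  shows "slice_emb I (z ^ n) = slice_emb I z ^ n"
proof (induction n)
  case 0
  show ?case using slice_emb_of_real[of I 1] by simp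
qed (simp add: slice_emb_mult[OF assms])

lemma slice_emb_surj: obtains I z where "I \<in> imag_units" "q = slice_emb I z"
proof -
  obtain I x y where "I \<in> imag_units" "q = slice_pt I x y"
    using ex_imag_unit_rep by blast
  then show thesis
    by (intro that[of I "Complex x y"]) (auto simp: slice_emb_def)
qed

lemma slice_proj_mult:
  assumes "I \<in> imag_units"
  shows "slice_proj I u (slice_emb I z * q) = z * slice_proj I u q"
proof -
  have I: "I * I = -1" using assms by (simp add: imag_units_def power2_eq_square)
  have II: "I * (I * q) = - q" by (simp add: I flip: mult.assoc)
  show ?thesis
    by (simp add: slice_proj_def slice_emb_def slice_pt_def complex_eq_iff algebra_simps II
        inner_add_right of_real_def)
qed

lemma bounded_linear_slice_proj: "bounded_linear (slice_proj I u)"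
proof -
  have "linear (slice_proj I u)"
    by (rule linearI) (simp_all add: slice_proj_def inner_add_right distrib_left complex_eq_iff)
  then show ?thesis by (simp add: linear_conv_bounded_linear)
qed

text \<open>
  For \<open>c = slice_proj I u q\<close>, multiplying \<open>q\<close> on the left by the point of the slice with
  coordinate \<open>cnj c\<close> makes the value real, and the Cauchy--Schwarz inequality applies.
\<close>

lemma norm_slice_proj_le:
  assumes "I \<in> imag_units"
  shows "norm (slice_proj I u q) \<le> norm u * norm q"
proof -
  have "(norm (slice_proj I u q))\<^sup>2 \<le> (norm u * norm q)\<^sup>2"
  proof (cases "u = 0")
    case True
    then show ?thesis by (simp add: slice_proj_def cmod_def)
  next
    case False
    define c where "c = slice_proj I u q"
    have 1: "u \<bullet> (slice_emb I (cnj c) * q) = Re (cnj c * c)"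
      using slice_proj_mult[OF assms, of u "cnj c" q] unfolding c_def
      by (metis slice_proj_def complex.sel(1))
    have "Re (cnj c * c) = (norm c)\<^sup>2"
      by (metis Re_complex_of_real complex_norm_square mult.commute)
    moreover have "u \<bullet> (slice_emb I (cnj c) * q) \<le> norm u * (norm c * norm q)"
      using norm_cauchy_schwarz[of u "slice_emb I (cnj c) * q"]
      by (simp add: norm_mult norm_slice_emb[OF assms])
    ultimately have "norm c * norm c \<le> norm c * (norm u * norm q)"
      using 1 by (simp add: power2_eq_square mult_ac)
    then have "norm c \<le> norm u * norm q"
      by (cases "c = 0") simp_all
    then show ?thesis unfolding c_def by (rule power_mono) simp
  qed
  then show ?thesis by (rule power2_le_imp_le) simp
qed

section \<open>Power series of slice regular functions\<close>

text \<open>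
  Continuity of the partial derivatives gives total differentiability on the slice, and the
  Cauchy--Riemann equation brings the differential into this form.
\<close>

lemma slice_has_derivative:
  assumes reg: "slice_regular_on f \<Omega>" and op: "open \<Omega>" and I: "I \<in> imag_units"
    and mem: "slice_emb I z \<in> \<Omega>"
  shows "((\<lambda>w. f (slice_emb I w)) has_derivative
           (\<lambda>v. slice_emb I v * slice_deriv f (slice_emb I z))) (at z)"
proof -
  define g where "g x y = f (slice_pt I x y)" for x y
  define D where "D = {(x, y). slice_pt I x y \<in> \<Omega>}"
  have dfx: "(\<lambda>s. g s y) differentiable (at x)"
    and dfy: "(\<lambda>t. g x t) differentiable (at y)"
    and cr: "slice_dx f I x y + I * slice_dy f I x y = 0" if "(x,y) \<in> D" for x y
    using reg I that unfolding slice_regular_on_def Let_def D_def g_def by fastforce+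
  have cont: "continuous_on D (\<lambda>(x, y). slice_dy f I x y)"
    using reg I by (simp add: slice_regular_on_def Let_def D_def)
  have "D = (\<lambda>p. slice_pt I (fst p) (snd p)) -` \<Omega>" by (auto simp: D_def)
  moreover have "continuous_on UNIV (\<lambda>p. slice_pt I (fst p) (snd p))"
    unfolding slice_pt_def by (intro continuous_intros)
  ultimately have "open D" using op by (simp add: open_vimage)
  define x y where "x = Re z" and "y = Im z"
  have xy: "(x,y) \<in> D" using mem by (simp add: D_def x_def y_def slice_emb_def)
  obtain A B where AB: "open A" "open B" "(x,y) \<in> A \<times> B" "A \<times> B \<subseteq> D"
    using open_prod_elim[OF \<open>open D\<close> xy] by blast
  obtain e where e: "e > 0" "ball y e \<subseteq> B" using AB open_contains_ball[of B] by auto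
  define Y where "Y = ball y e"
  have sub: "A \<times> Y \<subseteq> D" using AB e by (auto simp: Y_def)
  have dx: "((\<lambda>s. g s y) has_derivative (\<lambda>t. t *\<^sub>R slice_dx f I x y)) (at x within A)"
    using dfx[OF xy, unfolded vector_derivative_works]
    unfolding slice_dx_def g_def has_vector_derivative_def by (rule has_derivative_at_withinI)
  have dy: "((\<lambda>t. g s t) has_derivative
      blinfun_apply (blinfun_scaleR_left (slice_dy f I s t))) (at t within Y)"
    if "s \<in> A" "t \<in> Y" for s t
  proof -
    have "(s,t) \<in> D" using that sub by auto
    then have "((\<lambda>t. g s t) has_vector_derivative slice_dy f I s t) (at t)"
      using dfy[of s t] unfolding vector_derivative_works slice_dy_def g_def by blast
    then show ?thesis
      unfolding has_vector_derivative_def blinfun_scaleR_left.rep_eq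
      by (rule has_derivative_at_withinI)
  qed
  have "((\<lambda>(s,t). slice_dy f I s t) \<longlongrightarrow> slice_dy f I x y) (at (x,y) within A \<times> Y)"
    using continuous_on_subset[OF cont sub] AB(3) e(1) unfolding continuous_on_def Y_def by fastforce
  then have ct: "continuous (at (x,y) within A \<times> Y)
      (\<lambda>(s,t). blinfun_scaleR_left (slice_dy f I s t))"
    unfolding case_prod_unfold continuous_within fst_conv snd_conv
    by (rule bounded_linear.tendsto[OF bounded_linear_blinfun_scaleR_left])
  have "((\<lambda>(s,t). g s t) has_derivative (\<lambda>(tx, ty). tx *\<^sub>R slice_dx f I x y +
      blinfun_apply (blinfun_scaleR_left (slice_dy f I x y)) ty)) (at (x, y) within A \<times> Y)"
    by (rule has_derivative_partialsI[OF dx dy]) (use e ct in \<open>auto simp: Y_def\<close>)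
  then have "((\<lambda>(s,t). g s t) has_derivative (\<lambda>(tx, ty). tx *\<^sub>R slice_dx f I x y +
      blinfun_apply (blinfun_scaleR_left (slice_dy f I x y)) ty)) (at (Re z, Im z))"
    using AB e at_within_open[of "(x,y)" "A \<times> Y"]
    by (simp add: open_Times Y_def x_def y_def)
  then have "((\<lambda>(s,t). g s t) \<circ> (\<lambda>w. (Re w, Im w)) has_derivative
    (\<lambda>(tx, ty). tx *\<^sub>R slice_dx f I x y +
      blinfun_apply (blinfun_scaleR_left (slice_dy f I x y)) ty) \<circ> (\<lambda>w. (Re w, Im w))) (at z)"
    by (intro diff_chain_at has_derivative_Pair has_derivative_Re has_derivative_Im
        has_derivative_ident)
  moreover have sd: "slice_deriv f (slice_emb I z)
      = (1/2) *\<^sub>R (slice_dx f I x y - I * slice_dy f I x y)"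
    unfolding slice_emb_def x_def y_def
    by (rule slice_deriv_eq[OF reg I]) (use mem in \<open>simp add: slice_emb_def\<close>)
  have e1: "I * slice_dy f I x y = - slice_dx f I x y"
    using cr[OF xy] by (simp add: eq_neg_iff_add_eq_0 add.commute)
  then have sdx: "slice_deriv f (slice_emb I z) = slice_dx f I x y"
    unfolding sd by (simp add: scaleR_2 [symmetric])
  have II: "I * I = -1" using I by (simp add: imag_units_def power2_eq_square)
  have "I * (I * slice_dy f I x y) = - slice_dy f I x y" by (simp add: II flip: mult.assoc)
  then have sdy: "slice_dy f I x y = I * slice_dx f I x y"
    using e1 by simp
  ultimately show ?thesis
    unfolding sdx by (simp add: g_def o_def slice_emb_def sdy slice_pt_def
        distrib_right of_real_def blinfun_scaleR_left.rep_eq)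
qed

lemma slice_has_field_derivative:
  assumes "slice_regular_on f \<Omega>" "open \<Omega>" "I \<in> imag_units" "slice_emb I z \<in> \<Omega>"
  shows "((\<lambda>w. slice_proj I u (f (slice_emb I w))) has_field_derivative
           slice_proj I u (slice_deriv f (slice_emb I z))) (at z)"
proof -
  have "((\<lambda>w. slice_proj I u (f (slice_emb I w))) has_derivative
          (\<lambda>v. slice_proj I u (slice_emb I v * slice_deriv f (slice_emb I z)))) (at z)"
    by (rule bounded_linear.has_derivative[OF bounded_linear_slice_proj slice_has_derivative[OF assms]])
  moreover have "(\<lambda>v. v * c) = (*) c" for c :: complex by (simp add: fun_eq_iff mult.commute)
  ultimately show ?thesis
    unfolding has_field_derivative_def slice_proj_mult[OF assms(3)] by simp
qed

text \<open>
  The \<open>n\<close>-th derivative of \<open>f\<close> on the slice of \<open>I\<close>, in the complex coordinate, as an iterated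
  derivative in the real direction. At real points it does not involve the values of \<open>f\<close> off
  the real axis, hence does not depend on \<open>I\<close>.
\<close>

primrec slice_iter :: "(quat \<Rightarrow> quat) \<Rightarrow> quat \<Rightarrow> nat \<Rightarrow> complex \<Rightarrow> quat" where
  "slice_iter f I 0 z = f (slice_emb I z)"
| "slice_iter f I (Suc n) z = vector_derivative (\<lambda>t. slice_iter f I n (z + of_real t)) (at 0)"

text \<open>
  A quaternion is determined by the real parts of its images under \<open>slice_proj I b\<close> for basis
  vectors \<open>b\<close>; so differentiability of all \<open>slice_proj I u \<circ> d\<close> carries over to \<open>d\<close>.
\<close>

lemma has_vector_derivative_of_slice_proj:
  assumes "\<And>u. ((\<lambda>w. slice_proj I u (d w)) has_field_derivative c u) (at z)"
  obtains e where "((\<lambda>t. d (z + of_real t)) has_vector_derivative e) (at 0)"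
    "\<And>u. c u = slice_proj I u e"
proof -
  define e where "e = (\<Sum>b\<in>Basis. Re (c b) *\<^sub>R b)"
  have dc: "((\<lambda>t. slice_proj I u (d (z + of_real t))) has_vector_derivative c u) (at 0)" for u
  proof -
    have "((\<lambda>w. slice_proj I u (d w)) \<circ> (\<lambda>t. z + of_real t) has_vector_derivative 1 * c u) (at 0)"
      by (rule field_vector_diff_chain_at)
         (use assms[of u] in \<open>auto intro!: derivative_eq_intros simp: has_vector_derivative_def scaleR_conv_of_real\<close>)
    then show ?thesis by (simp add: o_def)
  qed
  have "((\<lambda>t. \<Sum>b\<in>Basis. Re (slice_proj I b (d (z + of_real t))) *\<^sub>R b) has_vector_derivative e) (at 0)"
    unfolding e_def
    by (intro has_vector_derivative_sum bounded_linear.has_vector_derivative[OF bounded_linear_scaleR_left]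
        bounded_linear.has_vector_derivative[OF bounded_linear_Re dc])
  moreover have "(\<Sum>b\<in>Basis. Re (slice_proj I b q) *\<^sub>R b) = q" for q
    by (simp add: slice_proj_def inner_commute[of _ q] euclidean_representation)
  ultimately have de: "((\<lambda>t. d (z + of_real t)) has_vector_derivative e) (at 0)" by simp
  have "c u = slice_proj I u e" for u
    using vector_derivative_unique_at[OF dc]
      bounded_linear.has_vector_derivative[OF bounded_linear_slice_proj de] by blast
  with de show thesis by (rule that)
qed

lemma slice_mem_ball:
  assumes "I \<in> imag_units" "z \<in> ball 0 1"
  shows "slice_emb I z \<in> ball 0 1"
  using assms by (simp add: norm_slice_emb)

lemma holomorphic_slice:
  assumes "slice_regular_on f (ball 0 1)" "I \<in> imag_units"
  shows "(\<lambda>w. slice_proj I u (f (slice_emb I w))) holomorphic_on ball 0 1"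
  unfolding holomorphic_on_open[OF open_ball]
  using slice_has_field_derivative[OF assms(1) open_ball assms(2) slice_mem_ball[OF assms(2)]] by blast

lemma slice_iter_deriv:
  assumes "slice_regular_on f (ball 0 1)" "I \<in> imag_units" "z \<in> ball 0 1"
  shows "(deriv ^^ n) (\<lambda>w. slice_proj I u (f (slice_emb I w))) z = slice_proj I u (slice_iter f I n z)"
  using assms(3)
proof (induction n arbitrary: z u)
  case (Suc n)
  let ?F = "\<lambda>u w. slice_proj I u (f (slice_emb I w))"
  have "((\<lambda>w. slice_proj I u (slice_iter f I n w)) has_field_derivative (deriv ^^ Suc n) (?F u) z) (at z)" for u
  proof -
    have "(deriv ^^ n) (?F u) holomorphic_on ball 0 1"
      by (intro holomorphic_higher_deriv holomorphic_slice assms(1,2)) auto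
    then have "((deriv ^^ n) (?F u) has_field_derivative (deriv ^^ Suc n) (?F u) z) (at z)"
      using holomorphic_derivI[OF _ open_ball Suc.prems] by simp
    then show ?thesis
      by (rule has_field_derivative_transform_within_open[OF _ open_ball Suc.prems])
         (use Suc.IH in auto)
  qed
  from has_vector_derivative_of_slice_proj[OF this] obtain e where
    e: "((\<lambda>t. slice_iter f I n (z + of_real t)) has_vector_derivative e) (at 0)"
    "\<And>u. (deriv ^^ Suc n) (?F u) z = slice_proj I u e" by blast
  then have "slice_iter f I (Suc n) z = e" by (simp add: vector_derivative_at)
  then show ?case using e(2) by simp
qed simp

lemma slice_iter_real:
  assumes "\<bar>x\<bar> < 1"
  shows "slice_iter f I n (of_real x) = slice_iter f J n (of_real x)"
  using assms
proof (induction n arbitrary: x)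
  case (Suc n)
  have "eventually (\<lambda>t. \<bar>x + t\<bar> < 1) (at (0::real))"
  proof (rule order_tendstoD(2))
    show "((\<lambda>t. \<bar>x + t\<bar>) \<longlongrightarrow> \<bar>x + 0\<bar>) (at 0)" by (intro tendsto_intros)
  qed (use Suc.prems in simp)
  then have ev: "eventually (\<lambda>t. slice_iter f I n (of_real x + of_real t) =
      slice_iter f J n (of_real x + of_real t)) (at 0)"
    by eventually_elim (simp add: Suc.IH flip: of_real_add)
  have ev': "eventually (\<lambda>t. slice_iter f I n (of_real x + of_real t) =
      slice_iter f J n (of_real x + of_real t)) (nhds 0)"
    using ev Suc.IH[OF Suc.prems] by (simp add: eventually_nhds_conv_at)
  show ?case by (simp only: slice_iter.simps)
      (rule vector_derivative_cong_eq, use ev' in auto)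
qed simp

text \<open>The Taylor coefficients of \<open>f\<close> at \<open>0\<close>; the choice of the slice is immaterial.\<close>

definition slice_coeff :: "(quat \<Rightarrow> quat) \<Rightarrow> nat \<Rightarrow> quat" where
  "slice_coeff f n = slice_iter f (Quat 0 1 0 0) n 0 /\<^sub>R fact n"

lemma slice_coeff_deriv:
  assumes "slice_regular_on f (ball 0 1)" "I \<in> imag_units"
  shows "(deriv ^^ n) (\<lambda>w. slice_proj I u (f (slice_emb I w))) 0 = fact n * slice_proj I u (slice_coeff f n)"
proof -
  have "slice_iter f I n 0 = fact n *\<^sub>R slice_coeff f n"
    using slice_iter_real[of 0 f I n "Quat 0 1 0 0"] by (simp add: slice_coeff_def)
  then show ?thesis
    unfolding slice_iter_deriv[OF assms, of 0 n u, simplified]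
    by (simp only: linear_scale[OF bounded_linear.linear[OF bounded_linear_slice_proj]])
      (simp only: scaleR_conv_of_real of_real_fact)
qed

lemma slice_power_series:
  assumes "slice_regular_on f (ball 0 1)" "norm q < 1"
  shows "(\<lambda>n. q ^ n * slice_coeff f n) sums f q"
proof -
  obtain I z where I: "I \<in> imag_units" and q: "q = slice_emb I z" by (rule slice_emb_surj)
  then have z: "z \<in> ball 0 1" using assms(2) by (simp add: norm_slice_emb)
  have "(\<lambda>n. u \<bullet> (q ^ n * slice_coeff f n)) sums (u \<bullet> f q)" for u
  proof -
    have "(\<lambda>n. fact n * slice_proj I u (slice_coeff f n) / fact n * z ^ n) sums slice_proj I u (f q)"
      using holomorphic_power_series[OF holomorphic_slice[OF assms(1) I] z, of u]
      by (simp add: slice_coeff_deriv[OF assms(1) I] q)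
    then have "(\<lambda>n. slice_proj I u (q ^ n * slice_coeff f n)) sums slice_proj I u (f q)"
      by (simp add: q slice_proj_mult[OF I] mult.commute flip: slice_emb_power[OF I])
    from sums_Re[OF this] show ?thesis by (simp add: slice_proj_def)
  qed
  then have "(\<lambda>n. \<Sum>b\<in>Basis. (b \<bullet> (q ^ n * slice_coeff f n)) *\<^sub>R b) sums (\<Sum>b\<in>Basis. (b \<bullet> f q) *\<^sub>R b)"
    by (intro sums_sum sums_scaleR_left)
  then show ?thesis by (simp add: inner_commute[of _ "_ * _"] inner_commute[of _ "f q"] euclidean_representation)
qed

text \<open>
  This is Cauchy's inequality for the derivative of the coordinate of \<open>f\<close> in the direction \<open>u\<close>
  equal to the coefficient itself.
\<close>

lemma slice_Cauchy_estimate: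
  assumes reg: "slice_regular_on f (ball 0 1)" and \<rho>: "0 < \<rho>" "\<rho> < 1"
    and M: "\<And>q. norm q = \<rho> \<Longrightarrow> norm (slice_deriv f q) \<le> M"
  shows "(1 + real n) * norm (slice_coeff f (Suc n)) * \<rho> ^ n \<le> M"
proof -
  define a where "a = slice_coeff f (Suc n)"
  obtain I z where I: "I \<in> imag_units" and "0 = slice_emb I z" by (rule slice_emb_surj)
  let ?F = "\<lambda>w. slice_proj I a (f (slice_emb I w))"
  have hol: "deriv ?F holomorphic_on ball 0 1"
    by (intro holomorphic_deriv holomorphic_slice reg I) auto
  have "norm ((deriv ^^ n) (deriv ?F) 0) \<le> fact n * (norm a * M) / \<rho> ^ n"
  proof (rule Cauchy_inequality)
    show "deriv ?F holomorphic_on ball 0 \<rho>"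
      by (rule holomorphic_on_subset[OF hol]) (use \<rho> in auto)
    show "continuous_on (cball 0 \<rho>) (deriv ?F)"
      by (rule continuous_on_subset[OF holomorphic_on_imp_continuous_on[OF hol]]) (use \<rho> in auto)
    fix x :: complex assume x: "norm (0 - x) = \<rho>"
    then have "deriv ?F x = slice_proj I a (slice_deriv f (slice_emb I x))"
      by (intro DERIV_imp_deriv slice_has_field_derivative[OF reg open_ball I])
         (use \<rho> in \<open>simp add: norm_slice_emb[OF I]\<close>)
    also have "norm \<dots> \<le> norm a * norm (slice_deriv f (slice_emb I x))"
      by (rule norm_slice_proj_le[OF I])
    also have "\<dots> \<le> norm a * M"
      using x by (intro mult_left_mono M) (simp_all add: norm_slice_emb[OF I])
    finally show "norm (deriv ?F x) \<le> norm a * M" .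
  qed (use \<rho> in auto)
  also have "(deriv ^^ n) (deriv ?F) 0 = fact (Suc n) * slice_proj I a a"
    using slice_coeff_deriv[OF reg I, of "Suc n" a] unfolding a_def[symmetric]
    by (simp only: funpow_Suc_right o_apply)
  finally have "fact n * ((1 + real n) * norm (slice_proj I a a)) \<le> fact n * (norm a * M / \<rho> ^ n)"
    by (simp add: norm_mult algebra_simps flip: of_nat_Suc)
  then have 1: "(1 + real n) * norm (slice_proj I a a) \<le> norm a * M / \<rho> ^ n"
    by (simp only: mult_le_cancel_left_pos fact_gt_zero)
  have "norm a * norm a \<le> norm (slice_proj I a a)"
    using complex_Re_le_cmod[of "slice_proj I a a"]
    by (simp add: slice_proj_def power2_norm_eq_inner flip: power2_eq_square)
  then have "(1 + real n) * (norm a * norm a) \<le> norm a * M / \<rho> ^ n"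
    using 1 by (meson mult_left_mono order_trans of_nat_0_le_iff add_nonneg_nonneg zero_le_one)
  then have 2: "norm a * ((1 + real n) * norm a * \<rho> ^ n) \<le> norm a * M"
    using \<rho> by (simp add: field_simps)
  have "0 \<le> M"
    using order_trans[OF norm_ge_zero M[of "of_real \<rho>"]] \<rho> by simp
  then show ?thesis
    using 2 mult_le_cancel_left_pos[of "norm a"] unfolding a_def[symmetric]
    by (cases "a = 0") simp_all
qed

section \<open>Perturbations of the identity\<close>

lemma norm_power_diff_le:
  fixes p q :: "'a::real_normed_algebra_1"
  assumes "norm p \<le> r" "norm q \<le> r"
  shows "norm (p ^ Suc n - q ^ Suc n) \<le> (1 + real n) * r ^ n * norm (p - q)"
proof (induction n)
  case (Suc n)
  have r: "0 \<le> r" using assms(1) norm_ge_zero order_trans by blast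
  have "p ^ Suc (Suc n) - q ^ Suc (Suc n) = p * (p ^ Suc n - q ^ Suc n) + (p - q) * q ^ Suc n"
    by (simp only: power_Suc[of _ "Suc n"]) (simp only: algebra_simps)
  also have "norm \<dots> \<le> norm p * norm (p ^ Suc n - q ^ Suc n) + norm (p - q) * norm (q ^ Suc n)"
    by (intro norm_triangle_le add_mono norm_mult_ineq)
  also have "\<dots> \<le> r * ((1 + real n) * r ^ n * norm (p - q)) + norm (p - q) * r ^ Suc n"
    using Suc r assms power_mono[OF assms(2) norm_ge_zero] norm_power_ineq[of q "Suc n"]
    by (intro add_mono mult_mono) (auto intro: order_trans simp del: power_Suc)
  also have "\<dots> = (1 + real (Suc n)) * r ^ Suc n * norm (p - q)"
    by (simp add: algebra_simps)
  finally show ?case .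
qed simp

text \<open>
  The preimages of \<open>w\<close> under \<open>f\<close> are the fixed points of the contraction \<open>q \<mapsto> w - (f q - q)\<close>.
  The domain is the preimage of the target ball; it is connected as the image of that ball under
  the continuous inverse.
\<close>

lemma perturbed_identity_homeomorphism:
  fixes f :: "'a::banach \<Rightarrow> 'a"
  assumes R: "0 < R" "R + \<delta> \<le> r" "0 \<le> r" and L: "0 \<le> L" "L < 1"
    and bound: "\<And>q. norm q \<le> r \<Longrightarrow> norm (f q - q) \<le> \<delta>"
    and lip: "\<And>p q. norm p \<le> r \<Longrightarrow> norm q \<le> r \<Longrightarrow>
                norm ((f p - p) - (f q - q)) \<le> L * norm (p - q)"
  obtains \<Omega> g where "\<Omega> \<subseteq> ball 0 r" "open \<Omega>" "connected \<Omega>" "\<Omega> \<noteq> {}"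
    "homeomorphism \<Omega> (ball 0 R) f g"
proof -
  have exp: "(1 - L) * norm (p - q) \<le> norm (f p - f q)"
    and con: "norm (f p - f q) \<le> (1 + L) * norm (p - q)"
    if "norm p \<le> r" "norm q \<le> r" for p q
    using lip[OF that] norm_triangle_ineq2[of "p - q" "(p - q) - (f p - f q)"]
      norm_triangle_ineq2[of "f p - f q" "p - q"]
    by (simp_all add: norm_minus_commute algebra_simps)
  have "\<exists>q. q \<in> ball 0 r \<and> f q = w" if w: "w \<in> ball 0 R" for w
  proof -
    have small: "norm (w - (f q - q)) < r" if "norm q \<le> r" for q
      using bound[OF that] w R norm_triangle_ineq4[of w "f q - q"] by simp
    have "\<exists>!q\<in>cball 0 r. w - (f q - q) = q"
    proof (rule Banach_fix[OF _ _ L])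
      show "complete (cball (0::'a) r)" by (simp add: complete_eq_closed)
      show "cball (0::'a) r \<noteq> {}" using R by simp
      show "(\<lambda>q. w - (f q - q)) ` cball 0 r \<subseteq> cball 0 r"
        using small by (auto dest!: small simp del: diff_diff_eq2)
      fix p q :: 'a assume "p \<in> cball 0 r" "q \<in> cball 0 r"
      then show "dist (w - (f p - p)) (w - (f q - q)) \<le> L * dist p q"
        using lip[of p q] by (simp add: dist_norm norm_minus_commute algebra_simps)
    qed
    then obtain q where q: "norm q \<le> r" "w - (f q - q) = q" by auto
    then have "norm q < r" using small[of q] by simp
    moreover have "f q = w" using q(2) by (simp add: algebra_simps)
    ultimately show ?thesis by auto
  qed
  then obtain g where g: "\<And>w. w \<in> ball 0 R \<Longrightarrow> g w \<in> ball 0 r \<and> f (g w) = w" by metis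
  define \<Omega> where "\<Omega> = ball 0 r \<inter> f -` ball 0 R"
  have gf: "g (f q) = q" if "q \<in> \<Omega>" for q
  proof -
    have "(1 - L) * norm (g (f q) - q) \<le> 0"
      using exp[of "g (f q)" q] g[of "f q"] that by (simp add: \<Omega>_def)
    then show ?thesis using L by (simp add: mult_le_0_iff)
  qed
  have cf: "continuous_on (ball 0 r) f"
    by (rule lipschitz_on_continuous_on[of "1 + L"], rule lipschitz_onI)
       (use con L in \<open>auto simp: dist_norm\<close>)
  have cg: "continuous_on (ball 0 R) g"
  proof (rule lipschitz_on_continuous_on[of "1 / (1 - L)"], rule lipschitz_onI)
    fix v w :: 'a assume "v \<in> ball 0 R" "w \<in> ball 0 R"
    then show "dist (g v) (g w) \<le> 1 / (1 - L) * dist v w"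
      using exp[of "g v" "g w"] g[of v] g[of w] L by (simp add: dist_norm field_simps)
  qed (use L in simp)
  have im: "g ` ball 0 R = \<Omega>"
  proof
    show "g ` ball 0 R \<subseteq> \<Omega>" using g by (auto simp: \<Omega>_def)
    show "\<Omega> \<subseteq> g ` ball 0 R" using gf by (metis IntD2 \<Omega>_def image_eqI subsetI vimageD)
  qed
  show thesis
  proof (rule that)
    show "\<Omega> \<subseteq> ball 0 r" by (simp add: \<Omega>_def)
    show "open \<Omega>" unfolding \<Omega>_def by (rule continuous_open_preimage[OF cf]) simp_all
    show "connected \<Omega>" unfolding im[symmetric]
      by (intro connected_continuous_image cg convex_connected convex_ball)
    show "\<Omega> \<noteq> {}" using R(1) unfolding im[symmetric] by simp
    show "homeomorphism \<Omega> (ball 0 R) f g"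
      unfolding homeomorphism_def
    proof (intro conjI ballI)
      show "f ` \<Omega> = ball 0 R"
      proof
        show "ball 0 R \<subseteq> f ` \<Omega>"
        proof
          fix w :: 'a assume "w \<in> ball 0 R"
          then show "w \<in> f ` \<Omega>" using g[of w] by (intro image_eqI[of _ _ "g w"]) (auto simp: \<Omega>_def)
        qed
      qed (auto simp: \<Omega>_def)
      show "continuous_on \<Omega> f" by (rule continuous_on_subset[OF cf]) (simp add: \<Omega>_def)
      show "g (f q) = q" if "q \<in> \<Omega>" for q using that by (rule gf)
      show "g ` ball 0 R = \<Omega>" by (rule im)
      show "continuous_on (ball 0 R) g" by (rule cg)
      show "f (g w) = w" if "w \<in> ball 0 R" for w using g[OF that] by simp
    qed
  qed
qed

section \<open>The lower bound for the Bloch constant\<close>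

lemma bloch_norm_le_1D:
  assumes "bloch_norm f \<le> 1" "norm q < 1"
  shows "norm (slice_deriv f q) \<le> 1 / (1 - (norm q)\<^sup>2)"
proof -
  have "ereal ((1 - (norm q)\<^sup>2) * norm (slice_deriv f q)) \<le> 1"
    using assms(1) unfolding bloch_norm_def SUP_le_iff using assms(2) by simp
  then have "(1 - (norm q)\<^sup>2) * norm (slice_deriv f q) \<le> 1"
    by (simp flip: one_ereal_def)
  moreover have "(norm q)\<^sup>2 < 1" using assms(2) by (simp add: abs_square_less_1)
  ultimately show ?thesis by (simp add: field_simps)
qed

lemma slice_coeff_0: "slice_coeff f 0 = f 0"
  using slice_emb_of_real[of _ 0] by (simp add: slice_coeff_def)

lemma slice_coeff_1:
  assumes "slice_regular_on f (ball 0 1)"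
  shows "slice_coeff f 1 = slice_deriv f 0"
proof -
  obtain I z where I: "I \<in> imag_units" and "0 = slice_emb I z" by (rule slice_emb_surj)
  have 0: "slice_emb I 0 = 0" using slice_emb_of_real[of I 0] by simp
  have "slice_proj I u (slice_coeff f 1) = slice_proj I u (slice_deriv f 0)" for u
    using slice_coeff_deriv[OF assms I, of 1 u]
      DERIV_imp_deriv[OF slice_has_field_derivative[OF assms open_ball I, of 0 u]] by (simp add: 0)
  then have "u \<bullet> slice_coeff f 1 = u \<bullet> slice_deriv f 0" for u
    by (simp add: slice_proj_def)
  then show ?thesis using vector_eq_ldot[of "slice_coeff f 1" "slice_deriv f 0"] by simp
qed

text \<open>
  Suppose \<open>a\<^sub>2 \<noteq> 0\<close> and let \<open>s\<close> be a real variable. The function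
  \<open>Re (f'(s a\<^sub>2\<^sup>-\<^sup>1)) - 1 / (1 - s\<^sup>2 |a\<^sub>2|\<^sup>-\<^sup>2)\<close> has a local maximum at \<open>s = 0\<close>, but its derivative
  there is \<open>2\<close>.
\<close>

lemma slice_coeff_2_eq_0:
  assumes reg: "slice_regular_on f (ball 0 1)" and d: "slice_deriv f 0 = 1" and b: "bloch_norm f \<le> 1"
  shows "slice_coeff f 2 = 0"
proof (rule ccontr)
  assume nz: "slice_coeff f 2 \<noteq> 0"
  obtain I c where I: "I \<in> imag_units" and c: "inverse (slice_coeff f 2) = slice_emb I c"
    by (rule slice_emb_surj)
  let ?F = "\<lambda>w. slice_proj I 1 (f (slice_emb I w))"
  have 0: "slice_emb I 0 = 0" using slice_emb_of_real[of I 0] by simp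
  have hol: "deriv ?F holomorphic_on ball 0 1"
    by (intro holomorphic_deriv holomorphic_slice reg I) auto
  have F': "Re (deriv ?F x) = 1 \<bullet> slice_deriv f (slice_emb I x)" if "norm x < 1" for x
    using DERIV_imp_deriv[OF slice_has_field_derivative[OF reg open_ball I, of x 1]] that
    by (simp add: norm_slice_emb[OF I] slice_proj_def)
  have "(deriv ?F has_field_derivative deriv (deriv ?F) 0) (at 0)"
    by (rule holomorphic_derivI[OF hol]) auto
  moreover have D: "deriv (deriv ?F) 0 = 2 * slice_proj I 1 (slice_coeff f 2)"
    using slice_coeff_deriv[OF reg I, of 2 1] by (simp add: numeral_2_eq_2)
  moreover have "((\<lambda>s. of_real s * c) has_vector_derivative of_real 1 * c) (at 0)"
    by (intro has_vector_derivative_mult_left has_vector_derivative_of_real DERIV_ident)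
  ultimately have "((\<lambda>s. deriv ?F (of_real s * c)) has_vector_derivative
      c * (2 * slice_proj I 1 (slice_coeff f 2))) (at 0)"
    using field_vector_diff_chain_at[of "\<lambda>s. of_real s * c" c 0 "deriv ?F"]
    by (simp add: o_def)
  moreover have "c * (2 * slice_proj I 1 (slice_coeff f 2)) = 2 * slice_proj I 1 1"
    using slice_proj_mult[OF I, of 1 c "slice_coeff f 2"] nz by (simp flip: c)
  moreover have "Re (2 * slice_proj I 1 1) = 2"
    by (simp add: slice_proj_def power2_norm_eq_inner[symmetric])
  ultimately have "((\<lambda>s. Re (deriv ?F (of_real s * c))) has_real_derivative 2) (at 0)"
    unfolding has_real_derivative_iff_has_vector_derivative
    using bounded_linear.has_vector_derivative[OF bounded_linear_Re,
        of "\<lambda>s. deriv ?F (of_real s * c)" "2 * slice_proj I 1 1" "at 0"] by simp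
  moreover have "((\<lambda>s. 1 / (1 - (s * norm c)\<^sup>2)) has_real_derivative 0) (at 0)"
    by (auto intro!: derivative_eq_intros)
  ultimately have der: "((\<lambda>s. Re (deriv ?F (of_real s * c)) - 1 / (1 - (s * norm c)\<^sup>2)) has_real_derivative 2 - 0) (at 0)"
    by (rule DERIV_diff)
  have "c \<noteq> 0" using nz 0 c by auto
  have "2 - 0 = (0::real)"
  proof (rule DERIV_local_max[OF der])
    show "0 < 1 / norm c" using \<open>c \<noteq> 0\<close> by simp
    show "\<forall>s. \<bar>0 - s\<bar> < 1 / norm c \<longrightarrow>
        Re (deriv ?F (of_real s * c)) - 1 / (1 - (s * norm c)\<^sup>2)
        \<le> Re (deriv ?F (of_real 0 * c)) - 1 / (1 - (0 * norm c)\<^sup>2)"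
    proof (intro allI impI)
      fix s :: real assume "\<bar>0 - s\<bar> < 1 / norm c"
      then have s: "norm (of_real s * c) < 1" using \<open>c \<noteq> 0\<close> by (simp add: norm_mult field_simps)
      let ?q = "slice_emb I (of_real s * c)"
      have "Re (deriv ?F (of_real s * c)) \<le> norm (slice_deriv f ?q)"
        unfolding F'[OF s] using norm_cauchy_schwarz[of 1 "slice_deriv f ?q"] by simp
      also have "\<dots> \<le> 1 / (1 - (s * norm c)\<^sup>2)"
        using bloch_norm_le_1D[OF b, of ?q] s
        by (simp add: norm_slice_emb[OF I] norm_mult power_mult_distrib)
      finally show "Re (deriv ?F (of_real s * c)) - 1 / (1 - (s * norm c)\<^sup>2)
          \<le> Re (deriv ?F (of_real 0 * c)) - 1 / (1 - (0 * norm c)\<^sup>2)"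
        by (simp add: F' 0 d power2_norm_eq_inner[symmetric])
    qed
  qed
  then show False by simp
qed

text \<open>The ratio is \<open>7/15 = (7/20) / (3/4)\<close>, and \<open>16/7 = 1 / (1 - (3/4)\<^sup>2)\<close>.\<close>

lemma geometric_majorant:
  "(\<lambda>n. 16/7 * (7/15) ^ (n + 2)) sums (14/15 :: real)"
proof -
  have "(\<lambda>n. (16/7 * (7/15)^2) * (7/15) ^ n) sums ((16/7 * (7/15)^2) * (1 / (1 - 7/15 :: real)))"
    by (intro sums_mult geometric_sums) simp
  moreover have "16/7 * (7/15) ^ (n + 2) = (16/7 * (7/15)^2) * (7/15 :: real) ^ n" for n
    by (simp only: power_add mult_ac)
  moreover have "(16/7 * (7/15)^2) * (1 / (1 - 7/15)) = (14/15 :: real)"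
    by (simp only: power2_eq_square) simp
  ultimately show ?thesis by (simp only:)
qed

lemma bloch_radius_ge:
  assumes reg: "slice_regular_on f (ball 0 1)" and f0: "f 0 = 0" and d: "slice_deriv f 0 = 1"
    and b: "bloch_norm f \<le> 1"
  shows "bloch_radius f \<ge> ereal (24/100)"
proof -
  define a where "a = slice_coeff f"
  define h where "h q = f q - q" for q
  have coeff: "(real n + 3) * norm (a (n + 3)) \<le> 16/7 * (4/3) ^ (n + 2)" for n
  proof -
    have "(1 + real (n + 2)) * norm (slice_coeff f (Suc (n + 2))) * (3/4) ^ (n + 2) \<le> 16/7"
    proof (rule slice_Cauchy_estimate[OF reg])
      fix q :: quat assume "norm q = 3/4"
      then show "norm (slice_deriv f q) \<le> 16/7"
        using bloch_norm_le_1D[OF b, of q] by (simp add: power2_eq_square del: eq_divide_eq_numeral1)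
    qed auto
    then have "(1 + real (n + 2)) * norm (slice_coeff f (Suc (n + 2))) \<le> 16/7 / (3/4) ^ (n + 2)"
      by (subst pos_le_divide_eq) auto
    then show ?thesis
      by (simp add: a_def power_divide add_ac eval_nat_numeral del: power_Suc)
  qed
  have h: "(\<lambda>n. q ^ (n + 3) * a (n + 3)) sums h q" if "norm q < 1" for q
  proof -
    have "(\<Sum>i<3. q ^ i * a i) = q"
      using slice_coeff_0[of f] slice_coeff_1[OF reg] slice_coeff_2_eq_0[OF reg d b] f0 d
      by (simp add: a_def eval_nat_numeral)
    then have "(\<lambda>n. q ^ n * a n) sums (h q + (\<Sum>i<3. q ^ i * a i))"
      using slice_power_series[OF reg that] by (simp only: a_def h_def diff_add_cancel)
    then show ?thesis using sums_iff_shift[of "\<lambda>n. q ^ n * a n" 3 "h q"] by (simp only:)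
  qed
  have bound: "norm (h q) \<le> 7/60 * (14/15)" if q: "norm q \<le> 7/20" for q
  proof (rule norm_sums_le[OF h])
    show "norm q < 1" using q by simp
    show "(\<lambda>n. 7/60 * (16/7 * (7/15) ^ (n + 2))) sums (7/60 * (14/15) :: real)"
      by (intro sums_mult geometric_majorant)
    fix n
    \<comment> \<open>dropping \<open>n\<close> from the factor \<open>n + 3\<close> in the coefficient bound accounts for the \<open>1/3\<close>\<close>
    have "norm (q ^ (n + 3) * a (n + 3)) \<le> (7/20) ^ (n + 3) * norm (a (n + 3))"
      unfolding norm_mult norm_power using q by (intro mult_right_mono power_mono) auto
    also have "3 * norm (a (n + 3)) \<le> (real n + 3) * norm (a (n + 3))"
      by (intro mult_right_mono) auto
    then have "norm (a (n + 3)) \<le> 1/3 * (16/7 * (4/3) ^ (n + 2))"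
      using coeff[of n] by linarith
    then have "(7/20) ^ (n + 3) * norm (a (n + 3)) \<le> (7/20) ^ (n + 3) * (1/3 * (16/7 * (4/3) ^ (n + 2)))"
      by (intro mult_left_mono) auto
    also have "\<dots> = 7/60 * (16/7 * ((7/20) ^ (n + 2) * (4/3) ^ (n + 2)))"
      by (simp add: eval_nat_numeral)
    also have "\<dots> = 7/60 * (16/7 * (7/15) ^ (n + 2))"
      by (simp only: power_mult_distrib[symmetric]) simp
    finally show "norm (q ^ (n + 3) * a (n + 3)) \<le> 7/60 * (16/7 * (7/15) ^ (n + 2))" .
  qed
  have lip: "norm (h p - h q) \<le> 14/15 * norm (p - q)"
    if pq: "norm p \<le> 7/20" "norm q \<le> 7/20" for p q
  proof (rule norm_sums_le[OF sums_diff[OF h h]])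
    show "norm p < 1" "norm q < 1" using pq by simp_all
    show "(\<lambda>n. 16/7 * (7/15) ^ (n + 2) * norm (p - q)) sums (14/15 * norm (p - q))"
      by (intro sums_mult2 geometric_majorant)
    fix n
    have "norm (p ^ (n + 3) * a (n + 3) - q ^ (n + 3) * a (n + 3))
        = norm (p ^ Suc (n + 2) - q ^ Suc (n + 2)) * norm (a (n + 3))"
      by (simp add: eval_nat_numeral flip: norm_mult left_diff_distrib)
    also have "\<dots> \<le> ((1 + real (n + 2)) * (7/20) ^ (n + 2) * norm (p - q)) * norm (a (n + 3))"
      by (intro mult_right_mono norm_power_diff_le pq) simp
    also have "\<dots> = ((7/20) ^ (n + 2) * norm (p - q)) * ((real n + 3) * norm (a (n + 3)))"
      by (simp add: algebra_simps)
    also have "\<dots> \<le> ((7/20) ^ (n + 2) * norm (p - q)) * (16/7 * (4/3) ^ (n + 2))"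
      by (intro mult_left_mono coeff) simp
    also have "\<dots> = 16/7 * ((7/20) ^ (n + 2) * (4/3) ^ (n + 2)) * norm (p - q)"
      by simp
    also have "\<dots> = 16/7 * (7/15) ^ (n + 2) * norm (p - q)"
      by (simp only: power_mult_distrib[symmetric]) simp
    finally show "norm (p ^ (n + 3) * a (n + 3) - q ^ (n + 3) * a (n + 3))
        \<le> 16/7 * (7/15) ^ (n + 2) * norm (p - q)" .
  qed
  obtain \<Omega> g where "\<Omega> \<subseteq> ball 0 (7/20)" "open \<Omega>" "connected \<Omega>" "\<Omega> \<noteq> {}"
    "homeomorphism \<Omega> (ball 0 (24/100)) f g"
    by (rule perturbed_identity_homeomorphism[of "24/100" "7/60 * (14/15)" "7/20" "14/15" f])
       (use bound lip in \<open>simp_all add: h_def\<close>)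
  moreover have "ball (0::quat) (7/20) \<subseteq> ball 0 1" by (simp add: subset_ball)
  ultimately have "\<exists>q0 \<Omega>. \<Omega> \<subseteq> ball 0 1 \<and> open \<Omega> \<and> connected \<Omega> \<and> \<Omega> \<noteq> {} \<and>
      (\<exists>g. homeomorphism \<Omega> (ball q0 (24/100)) f g)"
    by (meson subset_trans)
  then show ?thesis
    unfolding bloch_radius_def by (intro SUP_upper) simp
qed

theorem mainTheorem2:
  shows "bloch_const > ereal 0.23"
proof -
  have "ereal 0.23 < ereal (24/100)" by simp
  also have "\<dots> \<le> bloch_const"
    unfolding bloch_const_def by (rule INF_greatest) (use bloch_radius_ge in auto)
  finally show ?thesis .
qed

end
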